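(* There are exactly eighteen minimal exclusion sets over $\mathbb{Z}$ of length two, namely the nine sets $\overline{O_i}$ $(i=1,\dots,9)$ and their reversals, where \begin{align*} O_1 &= \{(1,1), (1,2),(2,1),(1,3)\},\\ O_2 &= \{(1,1), (1,2),(2,2),(1,3),(1,4)\},\\ O_3 &= \{(1,1),(1,2),(2,2),(1,3),(4,1),(4,2)\},\\ O_4 &=\{(1,1), (1,2),(2,2),(3,1),(3,2),(4,1),(4,2),(1,5)\},\\ O_5 &=\{(1,1), (1,2),(2,2),(3,1),(3,2),(4,1),(4,2),(5,2)\},\\ O_6 &=\{(1,1), (1,2),(2,2),(3,1),(3,2),(1,4),(4,2),(1,5)\},\\ O_7 &=\{(1,1), (1,2),(2,2),(3,1),(3,2),(1,4),(4,2),(5,2)\},\\ O_8 &=\{(1,1), (1,2),(2,2),(3,1),(3,2), (1,4),(3,4),(1,5)\},\\ O_9 &=\{(1,1), (1,2),(2,2),(3,1),(3,2), (1,4),(3,4),(5,2)\}. \end{align*}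
   Context: Continued fractions. For a sequence of integers $b_0,b_1,\dots$, the (negative) integer continued fraction $[b_0,b_1,\dots]$ is $b_0-\cfrac{1}{b_1-\cfrac{1}{b_2-\cdots}}$. Put $A_0=1$, $B_0=0$, $A_1=b_0$, $B_1=1$ and $A_{n+1}=b_nA_n-A_{n-1}$, $B_{n+1}=b_nB_n-B_{n-1}$ for $n\geq 1$. The convergents are $A_n/B_n\in\widehat{\mathbb{C}}=\mathbb{C}\cup\{\infty\}$, and the value of the finite continued fraction $[b_0,\dots,b_n]$ is $A_{n+1}/B_{n+1}$. An infinite continued fraction converges if its sequence of convergents converges in the topological space $\widehat{\mathbb{C}}$ (the Riemann sphere; convergence to $\infty$ is permitted), and otherwise it diverges. Words. A word is a nonempty finite sequence of integers $(x_1,\dots,x_n)$; a word of length one is written $x_1$. A word $x$ is a substring of $[b_0,b_1,\dots]$, or of a word $(b_0,\dots,b_m)$, if $x=(b_r,b_{r+1},\dots,b_s)$ for some $0\leq r\leq s$ (contiguous). A set of words $X$ is without redundancy if no element of $X$ is a substring of another element of $X$. The reversal of $X$ is the set obtained by reversing each word of $X$. Over $\mathbb{Z}$, define $\overline{X}=X\cup(-X)\cup\{0\}$, where $-X$ is obtained by negating all entries of each word and $0$ denotes the word of length one with entry $0$. $X$ is symmetric if $X=\overline{X}$. Exclusion sets. For a symmetric set $X$, $\mathrm{Ex}(X)$ is the set of all infinite integer continued fractions $[b_0,b_1,\dots]$ for which every tail $[b_n,b_{n+1},\dots]$ contains a substring from $X$. A symmetric set $X$ without redundancy is an exclusion set over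 $\mathbb{Z}$ if $\mathrm{Ex}(X)$ contains every divergent integer continued fraction. The length of an exclusion set is the supremum of the lengths of its words. Finite exclusion sets are partially ordered by $X\preceq Y$ iff $\mathrm{Ex}(X)\subseteq \mathrm{Ex}(Y)$. A minimal exclusion set of length $L$ is a minimal element of the poset of finite exclusion sets of length $L$. *)

theory Defs
  imports "HOL-Analysis.Analysis" "HOL-Library.Sublist" "HOL-Library.Extended_Nat"
begin

fun cf_num :: "(nat \<Rightarrow> int) \<Rightarrow> nat \<Rightarrow> int" where
  "cf_num b 0 = 1"
| "cf_num b (Suc 0) = b 0"
| "cf_num b (Suc (Suc n)) = b (Suc n) * cf_num b (Suc n) - cf_num b n"

fun cf_den :: "(nat \<Rightarrow> int) \<Rightarrow> nat \<Rightarrow> int" where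
  "cf_den b 0 = 0"
| "cf_den b (Suc 0) = 1"
| "cf_den b (Suc (Suc n)) = b (Suc n) * cf_den b (Suc n) - cf_den b n"

text \<open>The Riemann sphere is the one-point compactification of the complex plane; the value
  \<^term>\<open>None\<close> is the point at infinity.\<close>

definition riemann_sphere :: "complex option topology" where
  "riemann_sphere = Alexandroff_compactification euclidean"

text \<open>Numerator and denominator never vanish simultaneously, so a vanishing denominator
  always means that the convergent is infinity.\<close>

definition cf_convergent :: "(nat \<Rightarrow> int) \<Rightarrow> nat \<Rightarrow> complex option" where
  "cf_convergent b n =
     (if cf_den b n = 0 then None else Some (of_int (cf_num b n) / of_int (cf_den b n)))"

lemma cf_num_den_det: "cf_num b (Suc n) * cf_den b n - cf_num b n * cf_den b (Suc n) = - 1"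
  by (induction n) (auto simp: algebra_simps)

lemma cf_num_den_not_both_zero: "\<not> (cf_num b n = 0 \<and> cf_den b n = 0)"
  using cf_num_den_det[of b n] by auto

definition cf_converges :: "(nat \<Rightarrow> int) \<Rightarrow> bool" where
  "cf_converges b \<longleftrightarrow> (\<exists>l. limitin riemann_sphere (cf_convergent b) l sequentially)"

definition cf_diverges :: "(nat \<Rightarrow> int) \<Rightarrow> bool" where
  "cf_diverges b \<longleftrightarrow> \<not> cf_converges b"

definition word_set :: "int list set \<Rightarrow> bool" where
  "word_set X \<longleftrightarrow> [] \<notin> X"

definition cf_substring :: "int list \<Rightarrow> (nat \<Rightarrow> int) \<Rightarrow> bool" where
  "cf_substring x b \<longleftrightarrow> (\<exists>r s. r \<le> s \<and> x = map b [r..<Suc s])"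

definition cf_tail :: "nat \<Rightarrow> (nat \<Rightarrow> int) \<Rightarrow> nat \<Rightarrow> int" where
  "cf_tail n b = (\<lambda>k. b (n + k))"

text \<open>The contiguous substring relation between words is \<^const>\<open>sublist\<close>.\<close>

definition without_redundancy :: "int list set \<Rightarrow> bool" where
  "without_redundancy X \<longleftrightarrow> (\<forall>x\<in>X. \<forall>y\<in>X. x \<noteq> y \<longrightarrow> \<not> sublist x y)"

definition reversal :: "int list set \<Rightarrow> int list set" where
  "reversal X = rev ` X"

definition symm_closure :: "int list set \<Rightarrow> int list set" where
  "symm_closure X = X \<union> map uminus ` X \<union> {[0]}"

definition symmetric :: "int list set \<Rightarrow> bool" where
  "symmetric X \<longleftrightarrow> X = symm_closure X"

definition Ex_cf :: "int list set \<Rightarrow> (nat \<Rightarrow> int) set" where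
  "Ex_cf X = {b. \<forall>n. \<exists>x\<in>X. cf_substring x (cf_tail n b)}"

definition exclusion_set :: "int list set \<Rightarrow> bool" where
  "exclusion_set X \<longleftrightarrow>
     word_set X \<and> symmetric X \<and> without_redundancy X \<and> {b. cf_diverges b} \<subseteq> Ex_cf X"

definition exclusion_length :: "int list set \<Rightarrow> enat" where
  "exclusion_length X = (SUP x\<in>X. enat (length x))"

definition finite_exclusion_sets :: "enat \<Rightarrow> int list set set" where
  "finite_exclusion_sets L = {X. finite X \<and> exclusion_set X \<and> exclusion_length X = L}"

definition exclusion_le :: "int list set \<Rightarrow> int list set \<Rightarrow> bool" where
  "exclusion_le X Y \<longleftrightarrow> Ex_cf X \<subseteq> Ex_cf Y"

definition minimal_exclusion_set :: "enat \<Rightarrow> int list set \<Rightarrow> bool" where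
  "minimal_exclusion_set L X \<longleftrightarrow>
     X \<in> finite_exclusion_sets L \<and>
     (\<forall>Y\<in>finite_exclusion_sets L. exclusion_le Y X \<longrightarrow> Y = X)"

definition O1 :: "int list set" where
  "O1 = {[1,1], [1,2], [2,1], [1,3]}"

definition O2 :: "int list set" where
  "O2 = {[1,1], [1,2], [2,2], [1,3], [1,4]}"

definition O3 :: "int list set" where
  "O3 = {[1,1], [1,2], [2,2], [1,3], [4,1], [4,2]}"

definition O4 :: "int list set" where
  "O4 = {[1,1], [1,2], [2,2], [3,1], [3,2], [4,1], [4,2], [1,5]}"

definition O5 :: "int list set" where
  "O5 = {[1,1], [1,2], [2,2], [3,1], [3,2], [4,1], [4,2], [5,2]}"

definition O6 :: "int list set" where
  "O6 = {[1,1], [1,2], [2,2], [3,1], [3,2], [1,4], [4,2], [1,5]}"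

definition O7 :: "int list set" where
  "O7 = {[1,1], [1,2], [2,2], [3,1], [3,2], [1,4], [4,2], [5,2]}"

definition O8 :: "int list set" where
  "O8 = {[1,1], [1,2], [2,2], [3,1], [3,2], [1,4], [3,4], [1,5]}"

definition O9 :: "int list set" where
  "O9 = {[1,1], [1,2], [2,2], [3,1], [3,2], [1,4], [3,4], [5,2]}"

end

theory Submission
  imports Defs
begin

text \<open>The convergents of an integer continued fraction form a path in the Farey graph. If the path
  visits each vertex at most finitely often, then it crosses each rational only finitely often, so
  it converges in \<open>[-\<infinity>, \<infinity>]\<close>. The determinants \<open>A\<^sub>m B\<^sub>n - A\<^sub>n B\<^sub>m\<close> are continuants of the word
  \<open>b\<^sub>m\<^sub>+\<^sub>1, \<dots>, b\<^sub>n\<^sub>-\<^sub>1\<close>; when the pairs of one of the families \<open>O\<^sub>i\<close> are avoided, the ratios of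
  consecutive continuants are bounded away from zero by a constant depending on the last entry only.
  Hence no vertex is visited twice, and since continuants are invariant under reversal of the word,
  the same holds for the reversed family.

  Conversely, a periodic continued fraction whose period has a matrix of trace \<open>0\<close> or \<open>\<plusminus>1\<close> diverges,
  because that matrix has finite order. Nine such periods and their reversals, three of which contain
  an arbitrarily large integer \<open>N\<close> and so cannot be ruled out by letters or pairs of a finite set
  involving \<open>N\<close>, force every exclusion set of length two to lie above one of the eighteen. Finally,
  \<open>Ex(Y) \<subseteq> Ex(X)\<close> for finite \<open>X\<close> means that every word of \<open>Y\<close> has a substring in \<open>X\<close>, so the
  eighteen sets are pairwise incomparable.\<close>

section \<open>Convergence\<close>

text \<open>Zero exactly when the convergents \<open>m\<close> and \<open>n\<close> are the same
  vertex, so nonvanishing says that the path does not return to a vertex.\<close>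

definition cf_cross :: "(nat \<Rightarrow> int) \<Rightarrow> nat \<Rightarrow> nat \<Rightarrow> int" where
  "cf_cross b m n = cf_num b m * cf_den b n - cf_num b n * cf_den b m"

lemma cf_cross_right: "cf_cross b m (Suc (Suc n)) = b (Suc n) * cf_cross b m (Suc n) - cf_cross b m n"
  by (simp add: cf_cross_def algebra_simps)

lemma cf_cross_left: "cf_cross b (Suc (Suc m)) n = b (Suc m) * cf_cross b (Suc m) n - cf_cross b m n"
  by (simp add: cf_cross_def algebra_simps)

lemma cf_cross_self: "cf_cross b n n = 0"
  by (simp add: cf_cross_def)

lemma cf_cross_Suc: "cf_cross b n (Suc n) = 1"
  using cf_num_den_det[of b n] by (simp add: cf_cross_def)

definition admits :: "(int \<Rightarrow> real) \<Rightarrow> int \<Rightarrow> int \<Rightarrow> bool" where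
  "admits L p q \<longleftrightarrow> (p * q > 0 \<longrightarrow> L \<bar>q\<bar> \<le> \<bar>q\<bar> - 1 / L \<bar>p\<bar>)"

text \<open>The ratios of consecutive terms satisfy \<open>r' = q - 1 / r\<close>, so \<^const>\<open>admits\<close> makes
  \<open>L \<bar>q\<bar>\<close> a lower bound for \<open>\<bar>r'\<bar>\<close> whenever \<open>L \<bar>p\<bar>\<close> is one for \<open>\<bar>r\<bar>\<close>.\<close>

lemma recurrence_nonzero:
  fixes d c :: "nat \<Rightarrow> int" and L :: "int \<Rightarrow> real"
  assumes d0: "d 0 = 0" and d1: "d 1 \<noteq> 0"
    and rec: "\<And>k. k < n \<Longrightarrow> d (Suc (Suc k)) = c k * d (Suc k) - d k"
    and nz: "\<And>k. k < n \<Longrightarrow> c k \<noteq> 0"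
    and adm: "\<And>k. Suc k < n \<Longrightarrow> admits L (c k) (c (Suc k))"
    and L: "\<And>x. x \<ge> 1 \<Longrightarrow> 0 < L x \<and> L x \<le> x"
    and k: "k \<le> n"
  shows "d (Suc k) \<noteq> 0"
proof -
  have Lc: "0 < L \<bar>c k\<bar>" "L \<bar>c k\<bar> \<le> \<bar>c k\<bar>" if "k < n" for k
    using L[of "\<bar>c k\<bar>"] nz[OF that] by auto
  have ratio: "d (Suc k) \<noteq> 0 \<and> L \<bar>c k\<bar> \<le> sgn (c k) * (d (Suc (Suc k)) / d (Suc k))" if "k < n" for k
    using that
  proof (induction k)
    \<comment> \<open>Since \<open>d 0 = 0\<close>, the first ratio is exactly
      \<open>c 0\<close>.\<close>
    case 0
    then show ?case
      using d0 d1 rec[of 0] Lc(2)[of 0] by (simp add: abs_sgn mult.commute)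
  next
    case (Suc k)
    define r where "r = real_of_int (d (Suc (Suc k))) / d (Suc k)"
    have lt: "k < n" using Suc.prems by simp
    have nz1: "d (Suc k) \<noteq> 0" and lb: "L \<bar>c k\<bar> \<le> sgn (c k) * r"
      using Suc.IH[OF lt] by (simp_all add: r_def)
    have pos: "0 < sgn (c k) * r" using lb Lc(1)[OF lt] by linarith
    have r0: "r \<noteq> 0" using pos by auto
    then have nz2: "d (Suc (Suc k)) \<noteq> 0" by (auto simp: r_def)
    have inv: "1 / (sgn (c k) * r) \<le> 1 / L \<bar>c k\<bar>"
      using lb Lc(1)[OF lt] by (simp add: frac_le)
    have next_ratio: "d (Suc (Suc (Suc k))) / d (Suc (Suc k)) = c (Suc k) - 1 / r"
    proof -
      have "real_of_int (d (Suc (Suc (Suc k)))) = c (Suc k) * d (Suc (Suc k)) - d (Suc k)"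
        using rec[OF Suc.prems] by simp
      then show ?thesis using nz1 nz2 by (simp add: r_def field_simps)
    qed
    \<comment> \<open>If the signs of \<open>c k\<close> and \<open>c (Suc k)\<close> agree,
      \<open>admits\<close> gives the estimate once the bound on \<open>1 / r\<close> is inserted.
      If they differ, \<open>- 1 / r\<close> has the sign of \<open>c (Suc k)\<close> and only
      increases the absolute value.\<close>
    consider "c k > 0" "c (Suc k) > 0" | "c k < 0" "c (Suc k) < 0" | "c k > 0" "c (Suc k) < 0"
      | "c k < 0" "c (Suc k) > 0"
      using nz[OF lt] nz[OF Suc.prems] by linarith
    then have "L \<bar>c (Suc k)\<bar> \<le> sgn (c (Suc k)) * (c (Suc k) - 1 / r)"
    proof cases
      case 1
      then show ?thesis
        using adm[OF Suc.prems] inv by (simp add: admits_def)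
    next
      case 2
      then show ?thesis
        using adm[OF Suc.prems] inv by (simp add: admits_def mult_neg_neg)
    next
      case 3
      then have "1 / r > 0" using pos by simp
      moreover have "L \<bar>c (Suc k)\<bar> \<le> - c (Suc k)" using Lc(2)[OF Suc.prems] 3 by simp
      ultimately have "L \<bar>c (Suc k)\<bar> \<le> - (c (Suc k) - 1 / r)" by linarith
      with 3 show ?thesis by simp
    next
      case 4
      then have "1 / r < 0" using pos by (simp add: zero_less_mult_iff)
      moreover have "L \<bar>c (Suc k)\<bar> \<le> c (Suc k)" using Lc(2)[OF Suc.prems] 4 by simp
      ultimately have "L \<bar>c (Suc k)\<bar> \<le> c (Suc k) - 1 / r" by linarith
      with 4 show ?thesis by simp
    qed
    with nz2 next_ratio show ?case by simp
  qed
  show ?thesis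
  proof (cases k)
    case 0
    then show ?thesis using d1 by simp
  next
    case (Suc j)
    then have "j < n" using k by simp
    from ratio[OF this] Lc(1)[OF this] show ?thesis
      by (auto simp: Suc)
  qed
qed

text \<open>The recurrence can run in either index: with \<open>m\<close> fixed and \<open>n\<close>
  increasing it reads the entries forwards, with \<open>n\<close> fixed and \<open>m\<close>
  decreasing it reads them backwards. Thus one \<open>L\<close> serves a family and its
  reversal.\<close>

lemma cf_cross_nonzero:
  assumes nz: "\<And>k. k \<ge> N \<Longrightarrow> b k \<noteq> 0"
    and adm: "(\<forall>k\<ge>N. admits L (b k) (b (Suc k))) \<or> (\<forall>k\<ge>N. admits L (b (Suc k)) (b k))"
    and L: "\<And>x. x \<ge> 1 \<Longrightarrow> 0 < L x \<and> L x \<le> x"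
    and mn: "N \<le> m" "m < n"
  shows "cf_cross b m n \<noteq> 0"
  using adm
proof
  assume "\<forall>k\<ge>N. admits L (b k) (b (Suc k))"
  then have "cf_cross b m (m + Suc (n - Suc m)) \<noteq> 0"
    using nz mn
    by (intro recurrence_nonzero[where d = "\<lambda>k. cf_cross b m (m + k)" and
          c = "\<lambda>k. b (m + Suc k)" and n = "n - Suc m" and L = L])
      (simp_all add: cf_cross_right cf_cross_self cf_cross_Suc L)
  with mn show ?thesis by simp
next
  assume adm: "\<forall>k\<ge>N. admits L (b (Suc k)) (b k)"
  have "cf_cross b (n - Suc (n - Suc m)) n \<noteq> 0"
  proof (rule recurrence_nonzero[where d = "\<lambda>k. cf_cross b (n - k) n" and
          c = "\<lambda>k. b (n - Suc k)" and n = "n - Suc m" and L = L])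
    show "cf_cross b (n - 1) n \<noteq> 0"
      using mn cf_cross_Suc[of b "n - 1"] by simp
    show "cf_cross b (n - Suc (Suc k)) n
        = b (n - Suc k) * cf_cross b (n - Suc k) n - cf_cross b (n - k) n" if "k < n - Suc m" for k
      using cf_cross_left[of b "n - Suc (Suc k)" n] that by (simp add: Suc_diff_Suc)
    show "admits L (b (n - Suc k)) (b (n - Suc (Suc k)))" if "Suc k < n - Suc m" for k
      using adm[rule_format, of "n - Suc (Suc k)"] that mn by (simp add: Suc_diff_Suc)
  qed (use nz mn in \<open>auto simp: cf_cross_self L\<close>)
  with mn show ?thesis by simp
qed

section \<open>Limits on the Riemann sphere of paths without repeated vertices\<close>

lemma limitin_riemann_sphere_Some:
  assumes "(f \<longlongrightarrow> l) F"
  shows "limitin riemann_sphere (\<lambda>n. Some (f n)) (Some l) F"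
  using continuous_map_limit[OF continuous_map_Some, of euclidean f l F] assms
  by (simp add: riemann_sphere_def o_def)

lemma limitin_riemann_sphere_None:
  assumes "filterlim f at_infinity F"
  shows "limitin riemann_sphere (\<lambda>n. Some (f n)) None F"
  unfolding limitin_def
proof (intro conjI allI impI)
  fix U assume U: "openin riemann_sphere U \<and> None \<in> U"
  then obtain C where C: "compact C" "U = insert None (Some ` (UNIV - C))"
    by (auto simp: riemann_sphere_def openin_Alexandroff_compactification)
  obtain B where B: "\<And>z. z \<in> C \<Longrightarrow> norm z \<le> B"
    using compact_imp_bounded[OF C(1)] by (auto simp: bounded_iff)
  have "\<forall>\<^sub>F n in F. norm (f n) \<ge> \<bar>B\<bar> + 1"
    using assms by (simp add: filterlim_at_infinity[of 0])
  then show "\<forall>\<^sub>F n in F. Some (f n) \<in> U"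
    by eventually_elim (use B C in force)
qed (simp add: riemann_sphere_def)

text \<open>If the lower limit were below the upper one, the sequence could not stay eventually on
  one side of a rational strictly between them.\<close>

lemma convergent_if_rationals_separate:
  fixes v :: "nat \<Rightarrow> real"
  assumes "\<And>r. r \<in> \<rat> \<Longrightarrow> (\<forall>\<^sub>F n in sequentially. v n < r) \<or> (\<forall>\<^sub>F n in sequentially. v n > r)"
  shows "\<exists>l. (\<lambda>n. ereal (v n)) \<longlonglongrightarrow> l"
proof -
  let ?u = "\<lambda>n. ereal (v n)"
  have "liminf ?u = limsup ?u"
  proof (rule ccontr)
    assume "liminf ?u \<noteq> limsup ?u"
    then have "liminf ?u < limsup ?u"
      using Liminf_le_Limsup[of sequentially ?u] by simp
    then obtain r where r: "liminf ?u < ereal (real_of_rat r)" "ereal (real_of_rat r) < limsup ?u"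
      using ereal_dense3 by blast
    from assms[of "real_of_rat r"] show False
    proof
      assume "\<forall>\<^sub>F n in sequentially. v n < real_of_rat r"
      then have "limsup ?u \<le> ereal (real_of_rat r)"
        by (intro Limsup_bounded) (auto elim: eventually_mono)
      with r show False by simp
    next
      assume "\<forall>\<^sub>F n in sequentially. v n > real_of_rat r"
      then have "liminf ?u \<ge> ereal (real_of_rat r)"
        by (intro Liminf_bounded) (auto elim: eventually_mono)
      with r show False by simp
    qed simp
  qed
  then show ?thesis
    by (auto simp: tendsto_iff_Liminf_eq_Limsup)
qed

lemma eventually_same_side:
  fixes s :: "nat \<Rightarrow> real"
  assumes fin: "finite {n. n \<ge> N \<and> s n * s (Suc n) \<le> 0}"
  shows "(\<forall>\<^sub>F n in sequentially. s n < 0) \<or> (\<forall>\<^sub>F n in sequentially. s n > 0)"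
proof -
  obtain M where M: "\<And>n. n \<ge> N \<Longrightarrow> s n * s (Suc n) \<le> 0 \<Longrightarrow> n < M"
    using fin by (auto simp: finite_nat_set_iff_bounded)
  define K where "K = max M N"
  have step: "s n * s (Suc n) > 0" if "n \<ge> K" for n
    using M[of n] that by (force simp: K_def)
  have same: "s K * s n > 0" if "n \<ge> K" for n
    using that
  proof (induction n rule: dec_induct)
    case base
    then show ?case using step[of K] by (auto simp: zero_less_mult_iff)
  next
    case (step n)
    then show ?case using \<open>\<And>n. n \<ge> K \<Longrightarrow> s n * s (Suc n) > 0\<close>[of n] by (auto simp: zero_less_mult_iff)
  qed
  show ?thesis
  proof (cases "s K > 0")
    case True
    then have "\<forall>n\<ge>K. s n > 0" using same by (simp add: zero_less_mult_iff)
    then show ?thesis by (auto simp: eventually_sequentially)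
  next
    case False
    then have "\<forall>n\<ge>K. s n < 0" using same by (fastforce simp: zero_less_mult_iff)
    then show ?thesis by (auto simp: eventually_sequentially)
  qed
qed

text \<open>Consecutive convergents are neighbours in the Farey graph. Two neighbours on different sides
  of \<open>p / q\<close> both have denominator at most \<open>q\<close>, so a path without repeated vertices crosses
  each rational only finitely often.\<close>

lemma denominator_le_if_crossing:
  fixes A B A' B' p q :: int
  assumes det: "\<bar>A * B' - A' * B\<bar> = 1" and nz: "B \<noteq> 0" "B' \<noteq> 0" and q: "q > 0"
    and cross: "(A / B - p / q) * (A' / B' - p / q) \<le> (0 :: real)"
  shows "\<bar>B\<bar> \<le> q \<and> \<bar>A\<bar> \<le> \<bar>p\<bar> + q \<or> A * q = p * B \<or> A' * q = p * B'"
proof (rule disjCI)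
  assume ne: "\<not> (A * q = p * B \<or> A' * q = p * B')"
  define x y where "x = A * q - p * B" and "y = A' * q - p * B'"
  have xy0: "x \<noteq> 0" "y \<noteq> 0" using ne by (auto simp: x_def y_def)
  have "(A / B - p / q) * (A' / B' - p / q) = (x / (B * q)) * (y / (B' * q) :: real)"
    using nz q by (simp add: x_def y_def field_simps)
  also have "\<dots> = (x * B) * (y * B') / (B * B' * q)\<^sup>2"
    using nz q by (simp add: field_simps power2_eq_square)
  finally have "real_of_int ((x * B) * (y * B')) / (B * B' * q)\<^sup>2 \<le> 0"
    using cross by simp
  moreover have "(real_of_int (B * B' * q))\<^sup>2 > 0" using nz q by simp
  ultimately have "real_of_int ((x * B) * (y * B')) \<le> 0"
    by (simp add: divide_le_0_iff)
  \<comment> \<open>Opposite signs turn the triangle inequality into an equality: \<open>\<bar>x *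
    B'\<bar> + \<bar>y * B\<bar> = \<bar>x * B' - y * B\<bar> = q\<close>. As all four integers are
    nonzero, \<open>\<bar>B\<bar>\<close> and \<open>\<bar>x\<bar>\<close> are at most
    \<open>q\<close>, which also bounds \<open>\<bar>A\<bar>\<close>.\<close>
  then have opp: "(x * B') * (y * B) \<le> 0"
    by (simp add: mult_ac del: of_int_mult)
  have "x * B' - y * B = q * (A * B' - A' * B)"
    by (simp add: x_def y_def algebra_simps)
  then have "\<bar>x * B' - y * B\<bar> = q" using det q by (simp add: abs_mult)
  moreover have opposite: "\<bar>u\<bar> + \<bar>v\<bar> = \<bar>u - v\<bar>" if "u * v \<le> 0" for u v :: int
    using that by (auto simp: mult_le_0_iff)
  ultimately have "\<bar>x\<bar> * \<bar>B'\<bar> + \<bar>y\<bar> * \<bar>B\<bar> = q"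
    using opposite[OF opp] by (simp flip: abs_mult)
  moreover have "\<bar>x\<bar> * \<bar>B'\<bar> \<ge> \<bar>x\<bar>" "\<bar>y\<bar> * \<bar>B\<bar> \<ge> \<bar>B\<bar>"
    using nz xy0 by (simp_all add: mult_le_cancel_left1 mult_le_cancel_right1)
  moreover have "\<bar>x\<bar> \<ge> 0" by simp
  ultimately have B: "\<bar>B\<bar> \<le> q" and x: "\<bar>x\<bar> \<le> q" by linarith+
  have "\<bar>A\<bar> * q = \<bar>x + p * B\<bar>" using q by (simp add: x_def abs_mult)
  also have "\<dots> \<le> \<bar>x\<bar> + \<bar>p\<bar> * \<bar>B\<bar>" by (metis abs_mult abs_triangle_ineq)
  also have "\<dots> \<le> q + \<bar>p\<bar> * q" using B x by (simp add: add_mono mult_left_mono)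
  also have "\<dots> = (1 + \<bar>p\<bar>) * q" by (simp add: algebra_simps)
  finally have "\<bar>A\<bar> \<le> 1 + \<bar>p\<bar>" using q by simp
  with B q show "\<bar>B\<bar> \<le> q \<and> \<bar>A\<bar> \<le> \<bar>p\<bar> + q" by linarith
qed

text \<open>The vertices are distinct from index \<open>N\<close> on, and each rational is crossed
  only finitely often. Hence the real quotients have an extended real limit, and both infinite
  limits become the point \<open>None\<close>.\<close>

lemma cf_converges_if_cross_nonzero:
  assumes nz: "\<And>m n. N \<le> m \<Longrightarrow> m < n \<Longrightarrow> cf_cross b m n \<noteq> 0"
  shows "cf_converges b"
proof -
  define v where "v n = real_of_int (cf_num b n) / cf_den b n" for n
  have inj: "m = n" if "N \<le> m" "N \<le> n" "cf_cross b m n = 0" for m n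
  proof -
    have "cf_cross b n m = - cf_cross b m n" by (simp add: cf_cross_def)
    with that show ?thesis using nz[of m n] nz[of n m] by (cases m n rule: linorder_cases) auto
  qed
  have fin: "finite {n. N \<le> n \<and> cf_num b n * q = p * cf_den b n}" if "(p, q) \<noteq> (0, 0)" for p q
  proof -
    have "m = n" if "N \<le> m" "N \<le> n" "cf_num b m * q = p * cf_den b m"
        "cf_num b n * q = p * cf_den b n" for m n
    proof -
      have "q * cf_cross b m n
          = (cf_num b m * q) * cf_den b n - (cf_num b n * q) * cf_den b m"
        by (simp add: cf_cross_def algebra_simps)
      also have "\<dots> = 0" by (simp add: that(3,4))
      finally have "q * cf_cross b m n = 0" .
      moreover have "p * cf_cross b m n
          = cf_num b m * (p * cf_den b n) - cf_num b n * (p * cf_den b m)"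
        by (simp add: cf_cross_def algebra_simps)
      then have "p * cf_cross b m n = 0" by (simp flip: that(3,4))
      ultimately have "cf_cross b m n = 0" using \<open>(p, q) \<noteq> (0, 0)\<close> by auto
      with that show ?thesis using inj by blast
    qed
    then have "\<exists>m. {n. N \<le> n \<and> cf_num b n * q = p * cf_den b n} \<subseteq> {m}" by blast
    then show ?thesis by (meson finite.emptyI finite.insertI finite_subset)
  qed
  \<comment> \<open>The vertex at infinity is visited at most once, so \<open>v\<close> is a genuine
    quotient from \<open>M\<close> on.\<close>
  have "finite {n. N \<le> n \<and> cf_den b n = 0}"
    using fin[of 1 0] by (simp add: eq_commute[of 0])
  then obtain M0 where M0: "\<And>n. N \<le> n \<Longrightarrow> cf_den b n = 0 \<Longrightarrow> n < M0"
    by (auto simp: finite_nat_set_iff_bounded)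
  define M where "M = max M0 N"
  have den: "cf_den b n \<noteq> 0" if "n \<ge> M" for n
    using M0[of n] that by (force simp: M_def)
  have MN: "M \<ge> N" by (simp add: M_def)
  have "\<exists>l. (\<lambda>n. ereal (v n)) \<longlonglongrightarrow> l"
  proof (rule convergent_if_rationals_separate)
    fix r :: real assume "r \<in> \<rat>"
    then obtain p q :: int where q: "q > 0" and r: "r = p / q"
      by (auto elim: Rats_cases')
    let ?S = "{n. n \<ge> M \<and> (v n - r) * (v (Suc n) - r) \<le> 0}"
    let ?T = "{n. N \<le> n \<and> cf_num b n * q = p * cf_den b n}"
    let ?R = "{n. N \<le> n \<and> \<bar>cf_den b n\<bar> \<le> q \<and> \<bar>cf_num b n\<bar> \<le> \<bar>p\<bar> + q}"
    have "inj_on (\<lambda>n. (cf_num b n, cf_den b n)) ?R"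
      by (rule inj_onI) (auto intro!: inj simp: cf_cross_def)
    moreover have "(\<lambda>n. (cf_num b n, cf_den b n)) ` ?R \<subseteq> {- (\<bar>p\<bar> + q)..\<bar>p\<bar> + q} \<times> {-q..q}"
      by auto
    ultimately have "finite ?R"
      by (meson finite_SigmaI finite_atLeastAtMost_int inj_on_finite)
    moreover have "finite ?T" using q by (intro fin) auto
    \<comment> \<open>At a crossing, either vertex \<open>n\<close> is bounded in terms of
      \<open>p\<close> and \<open>q\<close>, or one of the two endpoints is \<open>p / q\<close>
      itself.\<close>
    moreover have "?S \<subseteq> ?R \<union> ?T \<union> {n. Suc n \<in> ?T}"
    proof
      fix n assume "n \<in> ?S"
      then have n: "n \<ge> M" "(v n - r) * (v (Suc n) - r) \<le> 0" by auto
      have "\<bar>cf_num b n * cf_den b (Suc n) - cf_num b (Suc n) * cf_den b n\<bar> = 1"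
        using cf_cross_Suc[of b n] by (simp add: cf_cross_def)
      moreover have "cf_den b n \<noteq> 0" "cf_den b (Suc n) \<noteq> 0" using n(1) den by simp_all
      ultimately have "\<bar>cf_den b n\<bar> \<le> q \<and> \<bar>cf_num b n\<bar> \<le> \<bar>p\<bar> + q \<or>
          cf_num b n * q = p * cf_den b n \<or> cf_num b (Suc n) * q = p * cf_den b (Suc n)"
        using q n(2)[unfolded v_def r] by (rule denominator_le_if_crossing)
      moreover have "N \<le> n" using n(1) MN by simp
      ultimately show "n \<in> ?R \<union> ?T \<union> {n. Suc n \<in> ?T}" by auto
    qed
    moreover have "finite {n. Suc n \<in> ?T}"
      using finite_vimageI[OF \<open>finite ?T\<close>, of Suc] by (simp add: vimage_def)
    ultimately have "finite ?S" by (meson finite_UnI finite_subset)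
    from eventually_same_side[OF this]
    show "(\<forall>\<^sub>F n in sequentially. v n < r) \<or> (\<forall>\<^sub>F n in sequentially. v n > r)" by simp
  qed
  then obtain l where l: "(\<lambda>n. ereal (v n)) \<longlonglongrightarrow> l" by blast
  have "\<exists>x. limitin riemann_sphere (\<lambda>n. Some (complex_of_real (v n))) x sequentially"
  proof (cases l)
    case (real x)
    with l have "v \<longlonglongrightarrow> x" by simp
    then have "(\<lambda>n. complex_of_real (v n)) \<longlonglongrightarrow> complex_of_real x" by (rule tendsto_of_real)
    from limitin_riemann_sphere_Some[OF this] show ?thesis ..
  next
    case PInf
    with l have "filterlim v at_top sequentially" by (simp add: tendsto_PInfty_eq_at_top)
    then have "filterlim (\<lambda>n. norm (v n)) at_top sequentially"
      by (intro filterlim_at_infinity_imp_norm_at_top filterlim_at_top_imp_at_infinity)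
    then have "filterlim (\<lambda>n. complex_of_real (v n)) at_infinity sequentially"
      by (intro filterlim_norm_at_top_imp_at_infinity) simp
    from limitin_riemann_sphere_None[OF this] show ?thesis ..
  next
    case MInf
    then have "filterlim (\<lambda>n. - v n) at_top sequentially"
      using tendsto_uminus_ereal[OF l] by (simp flip: tendsto_PInfty_eq_at_top)
    then have "filterlim (\<lambda>n. norm (- v n)) at_top sequentially"
      by (intro filterlim_at_infinity_imp_norm_at_top filterlim_at_top_imp_at_infinity)
    then have "filterlim (\<lambda>n. complex_of_real (v n)) at_infinity sequentially"
      by (intro filterlim_norm_at_top_imp_at_infinity) simp
    from limitin_riemann_sphere_None[OF this] show ?thesis ..
  qed
  then obtain x where x: "limitin riemann_sphere (\<lambda>n. Some (complex_of_real (v n))) x sequentially"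
    by blast
  have "\<forall>\<^sub>F n in sequentially. Some (complex_of_real (v n)) = cf_convergent b n"
    using eventually_ge_at_top[of M] by eventually_elim (simp add: cf_convergent_def v_def den)
  then have "limitin riemann_sphere (cf_convergent b) x sequentially"
    using x by (rule limitin_transform_eventually)
  then show ?thesis by (auto simp: cf_converges_def)
qed

section \<open>Divergent periodic continued fractions\<close>

text \<open>The tuple \<open>(a, b, c, d)\<close> stands for the matrix with rows \<open>(a, b)\<close> and \<open>(c, d)\<close>; the word
  \<open>[x\<^sub>1, \<dots>, x\<^sub>n]\<close> is sent to the product \<open>T x\<^sub>n \<cdots> T x\<^sub>1\<close>, where \<open>T x\<close> has rows \<open>(x, -1)\<close> and
  \<open>(1, 0)\<close>.\<close>

fun word_mat :: "int list \<Rightarrow> int \<times> int \<times> int \<times> int" where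
  "word_mat [] = (1, 0, 0, 1)"
| "word_mat (x # w) = (case word_mat w of (a, b, c, d) \<Rightarrow> (a * x + b, - a, c * x + d, - c))"

definition word_trace :: "int list \<Rightarrow> int" where
  "word_trace w = (case word_mat w of (a, b, c, d) \<Rightarrow> a + d)"

fun mat_app :: "int \<times> int \<times> int \<times> int \<Rightarrow> int \<times> int \<Rightarrow> int \<times> int" where
  "mat_app (a, b, c, d) (u, v) = (a * u + b * v, c * u + d * v)"

lemma word_mat_det: "word_mat w = (a, b, c, d) \<Longrightarrow> a * d - b * c = 1"
  by (induction w arbitrary: a b c d) (auto split: prod.splits simp: algebra_simps)

lemma word_mat_snoc:
  "word_mat (w @ [x]) = (case word_mat w of (a, b, c, d) \<Rightarrow> (x * a - c, x * b - d, a, b))"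
  by (induction w) (auto split: prod.splits simp: algebra_simps)

text \<open>Transposition followed by conjugation with the diagonal matrix with entries 1 and -1
  reverses products and fixes every \<open>T x\<close>.\<close>

lemma word_mat_rev: "word_mat (rev w) = (case word_mat w of (a, b, c, d) \<Rightarrow> (a, - c, - b, d))"
  by (induction w) (auto split: prod.splits simp: word_mat_snoc algebra_simps)

lemma word_trace_rev: "word_trace (rev w) = word_trace w"
  by (simp add: word_trace_def word_mat_rev split: prod.splits)

lemma word_trace_rotate: "word_trace (w @ [x]) = word_trace (x # w)"
  by (simp add: word_trace_def word_mat_snoc algebra_simps split: prod.splits)

text \<open>By Cayley-Hamilton the matrix satisfies \<open>M^2 = t M - 1\<close>. For
  \<open>t\<close> equal to 0, 1 or -1 its order divides 4, 6 or 3, and 12 is a common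
  multiple.\<close>

lemma mat_app_power_12:
  assumes "\<bar>word_trace w\<bar> \<le> 1"
  shows "(mat_app (word_mat w) ^^ 12) s = s"
proof -
  obtain a b c d where M: "word_mat w = (a, b, c, d)" by (cases "word_mat w")
  have det: "a * d - b * c = 1" using M by (rule word_mat_det)
  define t where "t = a + d"
  have t: "t = 0 \<or> t = 1 \<or> t = -1"
    using assms by (auto simp: t_def word_trace_def M)
  define f where "f k = (mat_app (word_mat w) ^^ k) s" for k
  have f_Suc: "f (Suc k) = (a * fst (f k) + b * snd (f k), c * fst (f k) + d * snd (f k))" for k
    by (cases "f k") (simp add: f_def M)
  have ch: "a * (a * u + b * v) + b * (c * u + d * v) = t * (a * u + b * v) - u"
    "c * (a * u + b * v) + d * (c * u + d * v) = t * (c * u + d * v) - v" for u v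
    using det unfolding t_def by algebra+
  have rec: "fst (f (Suc (Suc k))) = t * fst (f (Suc k)) - fst (f k)"
    "snd (f (Suc (Suc k))) = t * snd (f (Suc k)) - snd (f k)" for k
    using ch[of "fst (f k)" "snd (f k)"] by (simp_all only: f_Suc fst_conv snd_conv)
  have "fst (f 12) = fst (f 0)" "snd (f 12) = snd (f 0)"
    using t by (auto simp: eval_nat_numeral rec)
  then have "f 12 = f 0" by (rule prod_eqI)
  then show ?thesis by (simp add: f_def)
qed

lemma linear_recurrence_word:
  fixes s :: "nat \<Rightarrow> int \<times> int"
  assumes "\<And>n. s (Suc n) = (b n * fst (s n) - snd (s n), fst (s n))"
    and "\<And>i. i < length w \<Longrightarrow> b (n + i) = w ! i"
  shows "s (n + length w) = mat_app (word_mat w) (s n)"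
  using assms(2)
proof (induction w arbitrary: n)
  case Nil
  then show ?case by (cases "s n") simp
next
  case (Cons x w)
  have "s (Suc n + length w) = mat_app (word_mat w) (s (Suc n))"
    using Cons.prems[of "Suc _"] by (intro Cons.IH) simp
  moreover have "b n = x" using Cons.prems[of 0] by simp
  ultimately show ?case
    by (cases "s n") (simp add: assms(1) algebra_simps split: prod.splits)
qed

definition cyclic_seq :: "int list \<Rightarrow> nat \<Rightarrow> int" where
  "cyclic_seq w n = w ! (n mod length w)"

lemma linear_recurrence_cyclic:
  fixes s :: "nat \<Rightarrow> int \<times> int"
  assumes rec: "\<And>n. s (Suc n) = (cyclic_seq w n * fst (s n) - snd (s n), fst (s n))"
    and trace: "\<bar>word_trace w\<bar> \<le> 1"
  shows "s (k * (12 * length w)) = s 0"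
proof -
  have one: "s (n * length w + length w) = mat_app (word_mat w) (s (n * length w))" for n
    by (rule linear_recurrence_word[where b = "cyclic_seq w"])
      (simp_all add: rec cyclic_seq_def)
  have power: "s (n * length w) = (mat_app (word_mat w) ^^ n) (s 0)" for n
    by (induction n) (use one in \<open>simp_all add: add.commute\<close>)
  have "s (12 * k * length w) = s 0"
  proof (induction k)
    case (Suc k)
    have "s (12 * Suc k * length w) = (mat_app (word_mat w) ^^ (12 + 12 * k)) (s 0)"
      by (simp only: power mult_Suc_right)
    also have "\<dots> = (mat_app (word_mat w) ^^ 12) (s (12 * k * length w))"
      by (simp only: power funpow_add o_apply)
    finally show ?case using Suc.IH by (simp only: mat_app_power_12[OF trace])
  qed simp
  then show ?thesis by (simp only: mult_ac)
qed

text \<open>The recurrences start one step earlier, with \<open>A\<^sub>-\<^sub>1 = 0\<close> and \<open>B\<^sub>-\<^sub>1 = -1\<close>.\<close>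

lemma cf_num_den_cyclic:
  assumes trace: "\<bar>word_trace w\<bar> \<le> 1"
  defines "b \<equiv> cyclic_seq w"
  shows "cf_den b (k * (12 * length w)) = 0"
    and "cf_den b (Suc (k * (12 * length w))) = 1"
    and "cf_num b (Suc (k * (12 * length w))) = b 0"
proof -
  define s where "s n = (cf_num b n, if n = 0 then 0 else cf_num b (n - 1))" for n
  define s' where "s' n = (cf_den b n, if n = 0 then - 1 else cf_den b (n - 1))" for n
  have s_Suc: "s (Suc n) = (cyclic_seq w n * fst (s n) - snd (s n), fst (s n))" for n
    by (cases n) (simp_all add: s_def b_def)
  have s'_Suc: "s' (Suc n) = (cyclic_seq w n * fst (s' n) - snd (s' n), fst (s' n))" for n
    by (cases n) (simp_all add: s'_def b_def)
  let ?n = "k * (12 * length w)"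
  have s: "s ?n = (1, 0)" "s' ?n = (0, - 1)"
    using linear_recurrence_cyclic[of s w k] linear_recurrence_cyclic[of s' w k] trace s_Suc s'_Suc
    by (simp_all add: s_def s'_def)
  then show "cf_den b ?n = 0" by (simp add: s'_def)
  have b: "cyclic_seq w ?n = b 0" by (simp add: cyclic_seq_def b_def)
  show "cf_den b (Suc ?n) = 1" "cf_num b (Suc ?n) = b 0"
    using s_Suc[of ?n] s'_Suc[of ?n] s b by (simp_all add: s_def s'_def)
qed

text \<open>Every 12 periods the convergents return both to \<open>None\<close> and to the finite
  value \<open>b 0\<close>, so neither \<open>None\<close> nor a finite point can be the
  limit.\<close>

lemma cf_diverges_cyclic_seq:
  assumes "w \<noteq> []" "\<bar>word_trace w\<bar> \<le> 1"
  shows "cf_diverges (cyclic_seq w)"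
  unfolding cf_diverges_def
proof
  let ?b = "cyclic_seq w"
  define z where "z = complex_of_int (?b 0)"
  assume "cf_converges ?b"
  then obtain l where l: "limitin riemann_sphere (cf_convergent ?b) l sequentially"
    by (auto simp: cf_converges_def)
  have None: "cf_convergent ?b (k * (12 * length w)) = None" for k
    using cf_num_den_cyclic[OF assms(2)] by (simp add: cf_convergent_def)
  have Some: "cf_convergent ?b (Suc (k * (12 * length w))) = Some z" for k
    using cf_num_den_cyclic[OF assms(2)] by (simp add: cf_convergent_def z_def)
  have large: "n * (12 * length w) \<ge> n" for n using assms(1) by (cases w) simp_all
  show False
  proof (cases l)
    case None': None
    have "openin riemann_sphere (insert None (Some ` (UNIV - {z})))"
      unfolding riemann_sphere_def openin_Alexandroff_compactification
      by (intro disjI2 exI[of _ "{z}"]) simp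
    then have "\<forall>\<^sub>F n in sequentially. cf_convergent ?b n \<in> insert None (Some ` (UNIV - {z}))"
      using l None' unfolding limitin_def by blast
    then obtain n0 where "\<And>n. n \<ge> n0 \<Longrightarrow> cf_convergent ?b n \<in> insert None (Some ` (UNIV - {z}))"
      by (auto simp: eventually_sequentially)
    from this[of "Suc (n0 * (12 * length w))"] show False
      using large[of n0] by (auto simp: Some)
  next
    case (Some x)
    have "openin riemann_sphere (Some ` UNIV)"
      by (simp add: riemann_sphere_def)
    then have "\<forall>\<^sub>F n in sequentially. cf_convergent ?b n \<in> Some ` UNIV"
      using l Some unfolding limitin_def by blast
    then obtain n0 where "\<And>n. n \<ge> n0 \<Longrightarrow> cf_convergent ?b n \<in> Some ` UNIV"
      by (auto simp: eventually_sequentially)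
    from this[of "n0 * (12 * length w)"] show False
      using large[of n0] by (auto simp: None)
  qed
qed

section \<open>Closed walks that an exclusion set of length two must meet\<close>

definition covers :: "int list set \<Rightarrow> int \<Rightarrow> int \<Rightarrow> bool" where
  "covers X p q \<longleftrightarrow> [p] \<in> X \<or> [q] \<in> X \<or> [p, q] \<in> X"

text \<open>Appending \<open>hd w\<close> closes the walk, so that \<open>R\<close> holds between
  all cyclically consecutive letters; the trace condition makes the periodic sequence
  diverge.\<close>

definition avoidable :: "(int \<Rightarrow> int \<Rightarrow> bool) \<Rightarrow> bool" where
  "avoidable R \<longleftrightarrow> (\<exists>w. w \<noteq> [] \<and> \<bar>word_trace w\<bar> \<le> 1 \<and> successively R (w @ [hd w]))"

lemma exclusion_set_not_avoidable:
  assumes X: "exclusion_set X" and len: "\<And>x. x \<in> X \<Longrightarrow> length x \<le> 2"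
  shows "\<not> avoidable (\<lambda>p q. \<not> covers X p q)"
proof
  assume "avoidable (\<lambda>p q. \<not> covers X p q)"
  then obtain w where w: "w \<noteq> []" "\<bar>word_trace w\<bar> \<le> 1"
    and succ: "successively (\<lambda>p q. \<not> covers X p q) (w @ [hd w])"
    by (auto simp: avoidable_def)
  let ?b = "cyclic_seq w"
  have "?b \<in> Ex_cf X"
    using cf_diverges_cyclic_seq[OF w] X by (auto simp: exclusion_set_def)
  then obtain x where x: "x \<in> X" "cf_substring x (cf_tail 0 ?b)"
    by (auto simp: Ex_cf_def)
  then obtain r s where rs: "r \<le> s" "x = map ?b [r..<Suc s]"
    by (auto simp: cf_substring_def cf_tail_def)
  with len[OF x(1)] have "s = r \<or> s = Suc r" by auto
  \<comment> \<open>Whether the word found has one letter or two, it lies inside the pair of entries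
    at \<open>r\<close> and \<open>Suc r\<close>.\<close>
  with rs x(1) have cov: "covers X (?b r) (?b (Suc r))"
    by (auto simp: covers_def upt_rec)
  define i where "i = r mod length w"
  have i: "i < length w" using w(1) by (simp add: i_def)
  have 1: "(w @ [hd w]) ! i = ?b r" using i by (simp add: nth_append cyclic_seq_def i_def)
  have 2: "(w @ [hd w]) ! Suc i = ?b (Suc r)"
  proof (cases "Suc i = length w")
    case True
    then show ?thesis
      using w(1) by (simp add: nth_append cyclic_seq_def i_def mod_Suc hd_conv_nth)
  next
    case False
    then have "Suc i < length w" using i by simp
    then show ?thesis
      by (simp add: nth_append cyclic_seq_def i_def mod_Suc)
  qed
  show False
    using successively_nth[OF succ, of i] i cov by (simp only: 1 2) simp
qed

text \<open>The same cycle is read backwards from the same letter; the trace is invariant under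
  reversal and rotation of the word.\<close>

lemma avoidable_converse:
  assumes "avoidable (\<lambda>p q. R q p)"
  shows "avoidable R"
proof -
  obtain x u where w: "\<bar>word_trace (x # u)\<bar> \<le> 1" "successively (\<lambda>p q. R q p) (x # u @ [x])"
    using assms by (auto simp: avoidable_def neq_Nil_conv)
  have "successively R (rev (x # u @ [x]))" using w(2) by (simp only: successively_rev)
  then have "successively R ((x # rev u) @ [hd (x # rev u)])" by simp
  moreover have "word_trace (x # rev u) = word_trace (x # u)"
    using word_trace_rev[of "u @ [x]"] by (simp add: word_trace_rotate)
  ultimately show ?thesis
    using w(1) unfolding avoidable_def by (intro exI[of _ "x # rev u"]) simp
qed

text \<open>The blocks \<open>[2]\<close>, \<open>[1, 4]\<close> and \<open>[2, 5, 1]\<close> have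
  trace 2, so they are parabolic and the matrices of their repetitions are affine in
  \<open>k\<close>.\<close>

lemma word_mat_replicate_2:
  "word_mat (replicate k 2 @ [2]) = (2 + int k, - 1 - int k, 1 + int k, - int k)"
  by (induction k) (simp_all add: algebra_simps)

lemma word_mat_replicate_14:
  "word_mat (concat (replicate k [1, 4]) @ [1, 2]) = (1, - 2, 1 + int k, - 2 * int k - 1)"
  by (induction k) (simp_all add: algebra_simps)

lemma word_mat_replicate_251:
  "word_mat (concat (replicate k [2, 5, 1]) @ [2]) =
     (2 + 3 * int k, - 1 - 2 * int k, 1 + 6 * int k, - 4 * int k)"
  by (induction k) (simp_all add: algebra_simps)

lemma successively_concat_replicate:
  assumes "u \<noteq> []" "successively R (u @ [hd u])"
  shows "successively R (concat (replicate k u) @ [hd u])"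
proof (induction k)
  case (Suc k)
  have "hd (concat (replicate k u) @ [hd u]) = hd u"
    using assms(1) by (cases k) simp_all
  with Suc assms show ?case by (auto simp: successively_append_iff)
qed simp

text \<open>The letter \<open>N\<close> plays the role of an integer larger than all entries of the words to be avoided.
  The sequences containing \<open>N\<close> have length growing with \<open>N\<close>: their blocks reduce \<open>N\<close> step by step
  until the trace vanishes.\<close>

lemma not_avoidable_pairs:
  assumes R: "\<not> avoidable R" and N: "N \<ge> 3"
    and big: "\<And>p q. R p q \<Longrightarrow> R p N \<and> R N p \<and> R q N \<and> R N q"
  shows "\<not> R 1 1" "\<not> (R 1 2 \<and> R 2 1)" "\<not> (R 1 3 \<and> R 3 1)" "\<not> (R 1 2 \<and> R 2 2)"
    "\<not> (R 1 2 \<and> R 2 3 \<and> R 3 1)" "\<not> (R 1 2 \<and> R 2 4 \<and> R 4 1)" "\<not> (R 1 2 \<and> R 1 4 \<and> R 4 1)"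
    "\<not> (R 1 2 \<and> R 2 4 \<and> R 4 3 \<and> R 3 1)" "\<not> (R 1 2 \<and> R 2 5 \<and> R 5 1 \<and> R 3 1)"
proof -
  have R: "\<not> successively R (w @ [hd w])" if "w \<noteq> []" "\<bar>word_trace w\<bar> \<le> 1" for w
    using R that by (auto simp: avoidable_def)
  show "\<not> R 1 1" using R[of "[1]"] by (simp add: word_trace_def)
  show "\<not> (R 1 2 \<and> R 2 1)" using R[of "[1, 2]"] by (simp add: word_trace_def)
  show "\<not> (R 1 3 \<and> R 3 1)" using R[of "[1, 3]"] by (simp add: word_trace_def)
  show "\<not> (R 1 2 \<and> R 2 3 \<and> R 3 1)" using R[of "[1, 2, 3]"] by (simp add: word_trace_def)
  show "\<not> (R 1 2 \<and> R 2 4 \<and> R 4 1)" using R[of "[1, 2, 4]"] by (simp add: word_trace_def)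
  show "\<not> (R 1 2 \<and> R 2 4 \<and> R 4 3 \<and> R 3 1)"
    using R[of "[1, 2, 4, 3]"] by (simp add: word_trace_def)
  show "\<not> (R 1 2 \<and> R 2 2)"
  proof
    assume H: "R 1 2 \<and> R 2 2"
    \<comment> \<open>The trace of \<open>?w\<close> is \<open>N - 3 - k\<close>, here and in the
      two later cases with repeated blocks; \<open>N \<ge> 3\<close> makes this choice of
      \<open>k\<close> a valid length.\<close>
    define k where "k = nat (N - 3)"
    let ?w = "N # 1 # concat (replicate k [2]) @ [2]"
    have "successively R (concat (replicate k [2]) @ [hd [2]])"
      using H by (intro successively_concat_replicate) simp_all
    moreover have "hd (concat (replicate k [2]) @ [2, N]) = 2" by (cases k) simp_all
    ultimately have "successively R (?w @ [hd ?w])"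
      using H big[of 1 2] by (auto simp: successively_append_iff successively_Cons)
    moreover have "word_trace ?w = 0"
      using N by (simp add: word_trace_def word_mat_replicate_2 k_def algebra_simps)
    ultimately show False using R[of ?w] by simp
  qed
  show "\<not> (R 1 2 \<and> R 1 4 \<and> R 4 1)"
  proof
    assume H: "R 1 2 \<and> R 1 4 \<and> R 4 1"
    define k where "k = nat (N - 3)"
    let ?w = "N # concat (replicate k [1, 4]) @ [1, 2]"
    have "successively R (concat (replicate k [1, 4]) @ [hd [1, 4]])"
      using H by (intro successively_concat_replicate) simp_all
    moreover have "hd (concat (replicate k [1, 4]) @ [1, 2, N]) = 1" by (cases k) simp_all
    ultimately have "successively R (?w @ [hd ?w])"
      using H big[of 1 2] by (auto simp: successively_append_iff successively_Cons)
    moreover have "word_trace ?w = 0"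
      using N by (simp add: word_trace_def word_mat_replicate_14 k_def algebra_simps)
    ultimately show False using R[of ?w] by simp
  qed
  show "\<not> (R 1 2 \<and> R 2 5 \<and> R 5 1 \<and> R 3 1)"
  proof
    assume H: "R 1 2 \<and> R 2 5 \<and> R 5 1 \<and> R 3 1"
    define k where "k = nat (N - 3)"
    let ?w = "N # 3 # 1 # concat (replicate k [2, 5, 1]) @ [2]"
    have "successively R (concat (replicate k [2, 5, 1]) @ [hd [2, 5, 1]])"
      using H by (intro successively_concat_replicate) simp_all
    moreover have "hd (concat (replicate k [2, 5, 1]) @ [2, N]) = 2" by (cases k) simp_all
    ultimately have "successively R (?w @ [hd ?w])"
      using H big[of 2 5] big[of 3 1] by (auto simp: successively_append_iff successively_Cons)
    moreover have "word_trace ?w = 0"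
      using N by (simp add: word_trace_def word_mat_replicate_251 k_def algebra_simps)
    ultimately show False using R[of ?w] by simp
  qed
qed

section \<open>The order on exclusion sets\<close>

lemma cf_substring_sublist:
  assumes "cf_substring y b" "sublist x y" "x \<noteq> []"
  shows "cf_substring x b"
proof -
  obtain r s where rs: "r \<le> s" "y = map b [r..<Suc s]"
    using assms(1) by (auto simp: cf_substring_def)
  obtain us vs where y: "y = us @ x @ vs" using assms(2) by (auto simp: sublist_def)
  have len: "length us + length x + length vs = Suc s - r"
    using arg_cong[OF rs(2)[unfolded y], of length] by (simp del: upt_Suc)
  have nth: "x ! i = b (r + length us + i)" if "i < length x" for i
  proof -
    have "x ! i = y ! (length us + i)" using that by (simp add: y nth_append)
    also have "\<dots> = b (r + (length us + i))"
      unfolding rs(2) using that len by (subst nth_map) (auto simp del: upt_Suc)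
    finally show ?thesis by (simp add: add.assoc)
  qed
  obtain m where m: "length x = Suc m" using assms(3) by (cases x) auto
  have "x = map b [r + length us..<Suc (r + length us + m)]"
    using nth m by (intro nth_equalityI) (auto simp del: upt_Suc)
  then show ?thesis unfolding cf_substring_def using le_add1 by blast
qed

lemma Ex_cf_mono:
  assumes "\<And>y. y \<in> Y \<Longrightarrow> \<exists>x\<in>X. sublist x y" "word_set X"
  shows "Ex_cf Y \<subseteq> Ex_cf X"
proof
  fix b assume b: "b \<in> Ex_cf Y"
  have "\<exists>x\<in>X. cf_substring x (cf_tail n b)" for n
  proof -
    obtain y where y: "y \<in> Y" "cf_substring y (cf_tail n b)"
      using b unfolding Ex_cf_def by blast
    obtain x where x: "x \<in> X" "sublist x y" using assms(1)[OF y(1)] by blast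
    have "x \<noteq> []" using x(1) assms(2) by (auto simp: word_set_def)
    with cf_substring_sublist[OF y(2) x(2)] x(1) show ?thesis by blast
  qed
  then show "b \<in> Ex_cf X" unfolding Ex_cf_def by blast
qed

lemma fresh_int:
  fixes X :: "int list set"
  assumes "finite X"
  obtains N where "N \<ge> 3" "\<And>x. x \<in> X \<Longrightarrow> N \<notin> set x"
proof -
  have "finite (\<Union>x\<in>X. set x)" using assms by simp
  then have "infinite ({3..} - (\<Union>x\<in>X. set x))"
    using infinite_Ici[of "3 :: int"] by (simp add: Diff_infinite_finite)
  then obtain N where "N \<in> {3..} - (\<Union>x\<in>X. set x)"
    by (metis finite.emptyI ex_in_conv)
  then show thesis using that by auto
qed

text \<open>Repeating \<open>y\<close> with a fresh separator \<open>N\<close> gives a continued fraction in \<open>Ex_cf Y\<close> whose only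
  substrings without \<open>N\<close> are those of \<open>y\<close>.\<close>

lemma sublist_if_Ex_cf_subset:
  assumes sub: "Ex_cf Y \<subseteq> Ex_cf X" and X: "finite X" and y: "y \<in> Y" "y \<noteq> []"
  shows "\<exists>x\<in>X. sublist x y"
proof -
  obtain N where N: "\<And>x. x \<in> X \<Longrightarrow> N \<notin> set x" using fresh_int[OF X] by blast
  define w where "w = y @ [N]"
  define b where "b = cyclic_seq w"
  have lw: "length w = Suc (length y)" by (simp add: w_def)
  have b_w: "b (n * length w + i) = w ! i" if "i < length w" for n i
    using that by (simp add: b_def cyclic_seq_def)
  have b_y: "b (n * length w + i) = y ! i" if "i < length y" for n i
    using b_w[of i n] that lw by (simp add: w_def nth_append)
  have "b \<in> Ex_cf Y"
    unfolding Ex_cf_def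
  proof safe
    fix n
    \<comment> \<open>The start of copy number \<open>n\<close> of \<open>y\<close>, counted from
      position \<open>n\<close>; the subtraction is exact because \<open>w\<close> is
      nonempty.\<close>
    define r where "r = n * length w - n"
    have nr: "n + r = n * length w" by (simp add: r_def lw)
    have "cf_tail n b (r + i) = y ! i" if "i < length y" for i
      using b_y[OF that, of n] nr by (simp add: cf_tail_def add.assoc[symmetric])
    moreover obtain m where "length y = Suc m" using y(2) by (cases y) auto
    ultimately have "y = map (cf_tail n b) [r..<Suc (r + m)]"
      by (intro nth_equalityI) (auto simp del: upt_Suc)
    then have "cf_substring y (cf_tail n b)"
      unfolding cf_substring_def using le_add1 by blast
    with y(1) show "\<exists>x\<in>Y. cf_substring x (cf_tail n b)" by blast
  qed
  then obtain x where x: "x \<in> X" "cf_substring x (cf_tail 0 b)"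
    using sub unfolding Ex_cf_def by blast
  then obtain r s where rs: "r \<le> s" "x = map b [r..<Suc s]"
    by (auto simp: cf_substring_def cf_tail_def)
  define r0 n where "r0 = r mod length w" and "n = r div length w"
  have r: "r = n * length w + r0" by (simp add: r0_def n_def)
  have r0: "r0 \<le> length y" using mod_less_divisor[of "length w" r] by (simp add: r0_def lw)
  \<comment> \<open>\<open>N\<close> ends each period and does not occur in \<open>x\<close>, so
    \<open>x\<close> lies within a single copy of \<open>y\<close>.\<close>
  have inside: "r0 + (s - r) < length y"
  proof (rule ccontr)
    assume "\<not> r0 + (s - r) < length y"
    then have "n * length w + length y \<in> {r..s}" using r r0 rs(1) by auto
    then have "b (n * length w + length y) \<in> set x" by (auto simp: rs(2) simp del: upt_Suc)
    moreover have "b (n * length w + length y) = N"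
      using b_w[of "length y" n] lw by (simp add: w_def)
    ultimately show False using N[OF x(1)] by simp
  qed
  have "x = take (Suc (s - r)) (drop r0 y)"
  proof (rule nth_equalityI)
    fix i assume "i < length x"
    then have i: "i < Suc (s - r)" using rs by (simp del: upt_Suc)
    then have "x ! i = b (r + i)" using rs by (simp add: Suc_diff_le del: upt_Suc)
    also have "\<dots> = b (n * length w + (r0 + i))" by (simp only: r add.assoc)
    also have "\<dots> = y ! (r0 + i)" using i inside by (intro b_y) simp
    finally show "x ! i = take (Suc (s - r)) (drop r0 y) ! i" using i inside by simp
  qed (use rs inside in \<open>simp del: upt_Suc\<close>)
  then have "y = take r0 y @ x @ drop (Suc (s - r)) (drop r0 y)"
    by (metis append_take_drop_id)
  then have "sublist x y" by (metis sublist_appendI)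
  with x(1) show ?thesis by blast
qed

text \<open>A word of one set contains a word of the other, which in turn contains a word of the
  first. Absence of redundancy makes the outer two equal, hence all three.\<close>

lemma exclusion_le_antisym:
  assumes X: "finite X" "exclusion_set X" and Y: "finite Y" "exclusion_set Y"
    and le: "exclusion_le X Y" "exclusion_le Y X"
  shows "X = Y"
proof -
  have "A \<subseteq> B" if A: "finite A" "exclusion_set A" and B: "finite B" "exclusion_set B"
    and le: "exclusion_le A B" "exclusion_le B A" for A B
  proof
    fix x assume x: "x \<in> A"
    then have "x \<noteq> []" using A by (auto simp: exclusion_set_def word_set_def)
    with x le B obtain y where y: "y \<in> B" "sublist y x"
      using sublist_if_Ex_cf_subset unfolding exclusion_le_def by blast
    have "y \<noteq> []" using B y by (auto simp: exclusion_set_def word_set_def)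
    with y le A obtain x' where x': "x' \<in> A" "sublist x' y"
      using sublist_if_Ex_cf_subset unfolding exclusion_le_def by blast
    have "sublist x' x" using x' y sublist_order.order_trans by blast
    then have "x' = x"
      using A x x' unfolding exclusion_set_def without_redundancy_def by blast
    with x' y have "x = y" using sublist_order.order_antisym by blast
    with y show "x \<in> B" by simp
  qed
  with assms show ?thesis by (intro equalityI) blast+
qed

section \<open>The eighteen families\<close>

text \<open>\<open>admits\<close> demands nothing of opposite signs, and negation makes two negative
  entries positive, so conditions on positive pairs outside \<open>P\<close> suffice.\<close>

definition step_bounds :: "int list set \<Rightarrow> (int \<Rightarrow> real) \<Rightarrow> bool" where
  "step_bounds P L \<longleftrightarrow> (\<forall>x\<ge>1. 0 < L x \<and> L x \<le> x) \<and>
     (\<forall>p\<ge>1. \<forall>q\<ge>1. [p, q] \<notin> P \<longrightarrow> L q \<le> q - 1 / L p)"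

lemma symm_closure_idem: "symm_closure (symm_closure P) = symm_closure P"
  by (force simp: symm_closure_def image_Un image_image)

lemma reversal_symm_closure: "reversal (symm_closure X) = symm_closure (rev ` X)"
  by (simp add: reversal_def symm_closure_def image_Un image_image rev_map)

text \<open>A continued fraction outside \<open>Ex_cf\<close> has a tail free of 0 and of all listed
  pairs. From there on its steps are admissible in one direction, no vertex repeats, and it
  converges.\<close>

lemma exclusion_set_symm_closure:
  assumes pair: "\<And>x. x \<in> P \<Longrightarrow> length x = 2 \<and> 0 \<notin> set x"
    and adm: "(\<forall>p q. p \<noteq> 0 \<longrightarrow> q \<noteq> 0 \<longrightarrow> [p, q] \<notin> symm_closure P \<longrightarrow> admits L p q) \<or>
      (\<forall>p q. p \<noteq> 0 \<longrightarrow> q \<noteq> 0 \<longrightarrow> [p, q] \<notin> symm_closure P \<longrightarrow> admits L q p)"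
    and L: "\<And>x. x \<ge> 1 \<Longrightarrow> 0 < L x \<and> L x \<le> x"
  shows "exclusion_set (symm_closure P)"
  unfolding exclusion_set_def
proof (intro conjI)
  have pair': "x = [0] \<or> length x = 2 \<and> 0 \<notin> set x" if "x \<in> symm_closure P" for x
    using that pair by (auto simp: symm_closure_def)
  show "word_set (symm_closure P)" using pair' by (force simp: word_set_def)
  show "symmetric (symm_closure P)" by (simp add: symmetric_def symm_closure_idem)
  show "without_redundancy (symm_closure P)"
    unfolding without_redundancy_def
  proof (intro ballI impI notI)
    fix x y assume x: "x \<in> symm_closure P" and y: "y \<in> symm_closure P" and "x \<noteq> y" "sublist x y"
    then have "length x < length y" by (auto simp: sublist_def)
    moreover have "set x \<subseteq> set y" using \<open>sublist x y\<close> by (rule set_mono_sublist)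
    ultimately show False using pair'[OF x] pair'[OF y] by auto
  qed
  show "{b. cf_diverges b} \<subseteq> Ex_cf (symm_closure P)"
  proof
    fix b assume "b \<in> {b. cf_diverges b}"
    then have div: "\<not> cf_converges b" by (simp add: cf_diverges_def)
    show "b \<in> Ex_cf (symm_closure P)"
    proof (rule ccontr)
      assume "b \<notin> Ex_cf (symm_closure P)"
      then obtain N where N: "\<And>x. x \<in> symm_closure P \<Longrightarrow> \<not> cf_substring x (cf_tail N b)"
        by (auto simp: Ex_cf_def)
      have "cf_substring [b k] (cf_tail N b)" if "k \<ge> N" for k
        unfolding cf_substring_def cf_tail_def
        using that by (intro exI[of _ "k - N"]) simp
      then have nz: "b k \<noteq> 0" if "k \<ge> N" for k
        using N[of "[0]"] that by (metis symm_closure_def UnI2 singletonI)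
      have "cf_substring [b k, b (Suc k)] (cf_tail N b)" if "k \<ge> N" for k
        unfolding cf_substring_def cf_tail_def
        using that by (intro exI[of _ "k - N"] exI[of _ "Suc k - N"]) (simp add: Suc_diff_le)
      then have "[b k, b (Suc k)] \<notin> symm_closure P" if "k \<ge> N" for k
        using N that by blast
      with nz adm have "(\<forall>k\<ge>N. admits L (b k) (b (Suc k))) \<or> (\<forall>k\<ge>N. admits L (b (Suc k)) (b k))"
        by (meson le_Suc_eq)
      with nz L have "cf_cross b m n \<noteq> 0" if "N \<le> m" "m < n" for m n
        using cf_cross_nonzero that by blast
      then have "cf_converges b" by (rule cf_converges_if_cross_nonzero)
      with div show False by simp
    qed
  qed
qed

lemma exclusion_set_step_bounds:
  assumes P: "\<And>x. x \<in> P \<Longrightarrow> length x = 2 \<and> 0 \<notin> set x" and L: "step_bounds P L"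
  shows "exclusion_set (symm_closure P)" "exclusion_set (symm_closure (rev ` P))"
proof -
  have L_pos: "0 < L x \<and> L x \<le> x" if "x \<ge> 1" for x
    using L that by (simp add: step_bounds_def)
  have adm: "admits L p q" if "[p, q] \<notin> symm_closure P" for p q
    unfolding admits_def
  proof
    assume "0 < p * q"
    then consider "p \<ge> 1" "q \<ge> 1" | "- p \<ge> 1" "- q \<ge> 1"
      by (auto simp: zero_less_mult_iff)
    then show "L \<bar>q\<bar> \<le> \<bar>q\<bar> - 1 / L \<bar>p\<bar>"
    proof cases
      case 1
      moreover have "[p, q] \<notin> P" using that by (simp add: symm_closure_def)
      ultimately show ?thesis using L by (simp add: step_bounds_def)
    next
      case 2
      moreover have "[- p, - q] \<notin> P"
      proof
        assume "[- p, - q] \<in> P"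
        then have "map uminus [- p, - q] \<in> symm_closure P"
          unfolding symm_closure_def by blast
        with that show False by simp
      qed
      ultimately have "L (- q) \<le> real_of_int (- q) - 1 / L (- p)"
        using L unfolding step_bounds_def by blast
      with 2 show ?thesis by simp
    qed
  qed
  then show "exclusion_set (symm_closure P)"
    using L_pos P by (intro exclusion_set_symm_closure[of P L]) auto
  have "[q, p] \<notin> symm_closure P" if "[p, q] \<notin> symm_closure (rev ` P)" for p q
  proof
    assume "[q, p] \<in> symm_closure P"
    then have "rev [q, p] \<in> reversal (symm_closure P)"
      unfolding reversal_def by (rule imageI)
    with that show False by (simp add: reversal_symm_closure)
  qed
  with adm L_pos P show "exclusion_set (symm_closure (rev ` P))"
    by (intro exclusion_set_symm_closure[of "rev ` P" L]) auto
qed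

text \<open>Entries start at 1 while list positions start at 0; all integers from 6 on share the
  last value.\<close>

definition bound_table :: "real list \<Rightarrow> int \<Rightarrow> real" where
  "bound_table l x = l ! (nat (min x 6) - 1)"

text \<open>No pair of \<open>P\<close> contains a letter above 5, the table is constant from 6 on,
  and \<open>q - 1 / L p\<close> grows with \<open>q\<close>. So replacing \<open>p\<close> and
  \<open>q\<close> by their minima with 6 reduces the condition to 36 cases.\<close>

lemma step_bounds_table:
  assumes small: "\<forall>x\<in>P. \<forall>c\<in>set x. c \<le> 5"
    and pos: "\<forall>x\<in>set [1, 2, 3, 4, 5, 6]. 0 < bound_table l x \<and> bound_table l x \<le> of_int x"
    and table: "\<forall>p\<in>set [1, 2, 3, 4, 5, 6]. \<forall>q\<in>set [1, 2, 3, 4, 5, 6].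
      [p, q] \<notin> P \<longrightarrow> bound_table l q \<le> of_int q - 1 / bound_table l p"
  shows "step_bounds P (bound_table l)"
proof -
  have min: "bound_table l (min x 6) = bound_table l x" for x by (simp add: bound_table_def)
  have mem: "min x 6 \<in> set [1, 2, 3, 4, 5, 6]" if "x \<ge> 1" for x :: int
    using that by auto
  show ?thesis
    unfolding step_bounds_def
  proof (intro conjI allI impI)
    fix x :: int assume x: "x \<ge> 1"
    have "0 < bound_table l (min x 6) \<and> bound_table l (min x 6) \<le> of_int (min x 6)"
      using pos mem[OF x] by blast
    moreover have "of_int (min x 6) \<le> (of_int x :: real)" by simp
    ultimately show "0 < bound_table l x" "bound_table l x \<le> of_int x"
      unfolding min by linarith+
  next
    fix p q :: int assume p: "p \<ge> 1" and q: "q \<ge> 1" and pq: "[p, q] \<notin> P"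
    have "[min p 6, min q 6] \<notin> P"
    proof (cases "p \<le> 6 \<and> q \<le> 6")
      case True
      then show ?thesis using pq by simp
    next
      case False
      then have "6 \<in> set [min p 6, min q 6]" by auto
      then show ?thesis using small by fastforce
    qed
    then have "bound_table l (min q 6) \<le> of_int (min q 6) - 1 / bound_table l (min p 6)"
      using table mem[OF p] mem[OF q] by blast
    moreover have "of_int (min q 6) \<le> (of_int q :: real)" by simp
    ultimately show "bound_table l q \<le> of_int q - 1 / bound_table l p"
      unfolding min by linarith
  qed
qed

text \<open>Lists rather than sets, so that distinctness and inclusions can be evaluated.\<close>

definition pair_families :: "int list list list" where
  "pair_families = [
     [[1,1], [1,2], [2,1], [1,3]],
     [[1,1], [1,2], [2,2], [1,3], [1,4]],
     [[1,1], [1,2], [2,2], [1,3], [4,1], [4,2]],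
     [[1,1], [1,2], [2,2], [3,1], [3,2], [4,1], [4,2], [1,5]],
     [[1,1], [1,2], [2,2], [3,1], [3,2], [4,1], [4,2], [5,2]],
     [[1,1], [1,2], [2,2], [3,1], [3,2], [1,4], [4,2], [1,5]],
     [[1,1], [1,2], [2,2], [3,1], [3,2], [1,4], [4,2], [5,2]],
     [[1,1], [1,2], [2,2], [3,1], [3,2], [1,4], [3,4], [1,5]],
     [[1,1], [1,2], [2,2], [3,1], [3,2], [1,4], [3,4], [5,2]]]"

text \<open>Bounds for the entries \<open>1, \<dots>, 5\<close> and for all entries \<open>\<ge> 6\<close>, one row for each family.\<close>

definition family_bounds :: "real list list" where
  "family_bounds = [
     [1/2, 1, 2, 2, 2, 2],
     [1/3, 3/2, 2, 2, 2, 2],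
     [1/3, 3/2, 2, 1, 2, 2],
     [2/5, 5/3, 1/2, 3/2, 3, 3],
     [2/5, 5/3, 1/2, 3/2, 5/2, 7/2],
     [2/5, 5/3, 1/2, 2, 3, 7/2],
     [2/5, 5/3, 1/2, 2, 5/2, 7/2],
     [2/5, 5/3, 1/2, 3, 3, 7/2],
     [2/5, 5/3, 1/2, 3, 5/2, 7/2]]"

lemma pair_families_step_bounds:
  "list_all2 (\<lambda>P l. step_bounds (set P) (bound_table l)) pair_families family_bounds"
  unfolding pair_families_def family_bounds_def list_all2_Cons list_all2_Nil
  by (intro conjI refl step_bounds_table) (simp_all add: bound_table_def)

definition all_families :: "int list list list" where
  "all_families = pair_families @ map (map rev) pair_families"

lemma all_families_pairs:
  "P \<in> set all_families \<Longrightarrow> x \<in> set P \<Longrightarrow> length x = 2 \<and> (\<forall>c\<in>set x. 0 < c)"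
proof -
  have "\<forall>P\<in>set all_families. \<forall>x\<in>set P. length x = 2 \<and> (\<forall>c\<in>set x. 0 < c)"
    by code_simp
  then show "P \<in> set all_families \<Longrightarrow> x \<in> set P \<Longrightarrow> length x = 2 \<and> (\<forall>c\<in>set x. 0 < c)" by blast
qed

lemma all_families_antichain:
  assumes "P \<in> set all_families" "Q \<in> set all_families" "set P \<subseteq> set Q"
  shows "P = Q"
proof -
  have "\<forall>P\<in>set all_families. \<forall>Q\<in>set all_families. (\<forall>x\<in>set P. x \<in> set Q) \<longrightarrow> P = Q"
    by code_simp
  with assms show ?thesis by blast
qed

lemma distinct_all_families: "distinct all_families" and length_all_families: "length all_families = 18"
  by code_simp+

lemma all_families_exclusion:
  assumes "P \<in> set all_families"
  shows "symm_closure (set P) \<in> finite_exclusion_sets 2"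
proof -
  have pairs: "length x = 2 \<and> 0 \<notin> set x" if "P \<in> set all_families" "x \<in> set P" for P x
    using all_families_pairs[OF that] by auto
  have "exclusion_set (symm_closure (set P))"
  proof -
    have bounds: "\<exists>L. step_bounds (set Q) L" if "Q \<in> set pair_families" for Q
      using pair_families_step_bounds that by (metis list_all2_conv_all_nth in_set_conv_nth)
    from assms consider "P \<in> set pair_families" | Q where "Q \<in> set pair_families" "P = map rev Q"
      by (auto simp: all_families_def)
    then show ?thesis
    proof cases
      case 1
      with bounds obtain L where "step_bounds (set P) L" by blast
      with exclusion_set_step_bounds(1) pairs[OF assms] show ?thesis by blast
    next
      case 2
      then obtain L where L: "step_bounds (set Q) L" using bounds by blast
      have "Q \<in> set all_families" using 2 by (simp add: all_families_def)
      from exclusion_set_step_bounds(2)[OF pairs[OF this] L] show ?thesis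
        by (simp add: 2)
    qed
  qed
  moreover have "exclusion_length (symm_closure (set P)) = 2"
  proof -
    have le: "length x \<le> 2" if "x \<in> symm_closure (set P)" for x
      using that pairs[OF assms] by (auto simp: symm_closure_def)
    have "P \<noteq> []" using assms by (auto simp: all_families_def pair_families_def)
    then obtain x where "x \<in> set P" by (cases P) auto
    then have "x \<in> symm_closure (set P)" "length x = 2"
      using pairs[OF assms] by (auto simp: symm_closure_def)
    then have "enat 2 \<le> exclusion_length (symm_closure (set P))"
      unfolding exclusion_length_def by (metis SUP_upper)
    moreover have "exclusion_length (symm_closure (set P)) \<le> enat 2"
      unfolding exclusion_length_def by (intro SUP_least) (simp add: le)
    ultimately show ?thesis by (simp add: numeral_eq_enat)
  qed
  moreover have "finite (symm_closure (set P))" by (simp add: symm_closure_def)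
  ultimately show ?thesis by (simp add: finite_exclusion_sets_def)
qed

section \<open>Completeness, minimality and the count\<close>

lemma family_covered:
  assumes R: "\<not> avoidable (\<lambda>p q. \<not> C p q)" and N: "N \<ge> 3"
    and big: "\<And>p q. \<not> C p q \<Longrightarrow> \<not> C p N \<and> \<not> C N p \<and> \<not> C q N \<and> \<not> C N q"
  shows "\<exists>P\<in>set all_families. \<forall>x\<in>set P. C (x ! 0) (x ! 1)"
proof -
  have R': "\<not> avoidable (\<lambda>p q. \<not> C q p)" using R avoidable_converse[of "\<lambda>p q. \<not> C p q"] by blast
  have big': "\<not> C N p \<and> \<not> C p N \<and> \<not> C N q \<and> \<not> C q N" if "\<not> C q p" for p q
    using big[OF that] by blast
  \<comment> \<open>Each clause says that some pair of a cycle is covered. With every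
    \<open>C i j\<close> read as a propositional atom, any way of satisfying the clauses for the
    nine cycles and their reversals contains one of the eighteen families.\<close>
  note clauses = not_avoidable_pairs[OF R N big] not_avoidable_pairs[OF R' N big']
  show ?thesis
    unfolding all_families_def pair_families_def using clauses by (simp; argo)
qed

lemma family_below:
  assumes X: "X \<in> finite_exclusion_sets 2"
  shows "\<exists>P\<in>set all_families. exclusion_le (symm_closure (set P)) X"
proof -
  have fin: "finite X" and excl: "exclusion_set X" and L: "exclusion_length X = 2"
    using X by (simp_all add: finite_exclusion_sets_def)
  have len: "length x \<le> 2" if "x \<in> X" for x
  proof -
    have "enat (length x) \<le> 2"
      using L that unfolding exclusion_length_def by (metis SUP_upper)
    then show ?thesis by (simp add: numeral_eq_enat)
  qed
  obtain N where N: "N \<ge> 3" "\<And>x. x \<in> X \<Longrightarrow> N \<notin> set x" using fresh_int[OF fin] by blast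
  have "\<not> avoidable (\<lambda>p q. \<not> covers X p q)"
    using exclusion_set_not_avoidable[OF excl len] .
  \<comment> \<open>A pair containing \<open>N\<close> can be covered only by its other letter as a
    word of length one, and that letter would cover the pair \<open>p\<close>, \<open>q\<close>
    too.\<close>
  moreover have "\<not> covers X p q \<Longrightarrow> \<not> covers X p N \<and> \<not> covers X N p \<and> \<not> covers X q N \<and> \<not> covers X N q"
    for p q using N(2) by (force simp: covers_def)
  ultimately obtain P where P: "P \<in> set all_families" "\<forall>x\<in>set P. covers X (x ! 0) (x ! 1)"
    using family_covered[OF _ N(1)] by blast
  have sym: "symm_closure X = X" and words: "word_set X"
    using excl by (simp_all add: exclusion_set_def symmetric_def)
  have covered: "\<exists>x\<in>X. sublist x y" if y: "y \<in> set P" for y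
  proof -
    obtain p q where pq: "y = [p, q]"
      using all_families_pairs[OF P(1) y] by (auto simp: numeral_2_eq_2 length_Suc_conv)
    then have "covers X p q" using P(2) y by auto
    moreover have "sublist [p] y" "sublist [q] y" "sublist [p, q] y"
      by (auto simp: pq sublist_Cons_right)
    ultimately show ?thesis unfolding covers_def by blast
  qed
  have "\<exists>x\<in>X. sublist x y" if "y \<in> symm_closure (set P)" for y
    using that unfolding symm_closure_def
  proof (elim UnE)
    assume "y \<in> map uminus ` set P"
    then obtain z where z: "z \<in> set P" "y = map uminus z" by blast
    obtain x where x: "x \<in> X" "sublist x z" using covered[OF z(1)] by blast
    have "map uminus x \<in> X" using x(1) sym unfolding symm_closure_def by blast
    moreover have "sublist (map uminus x) y" unfolding z(2) using x(2) by (rule map_mono_sublist)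
    ultimately show ?thesis by blast
  next
    assume "y \<in> {[0]}"
    moreover have "[0] \<in> X" using sym unfolding symm_closure_def by blast
    ultimately show ?thesis by auto
  qed (rule covered)
  from Ex_cf_mono[OF this words] P(1) show ?thesis by (auto simp: exclusion_le_def)
qed

text \<open>A word of \<open>P\<close> is positive, so the word of the other closure inside it is
  neither \<open>[0]\<close> nor negated. It lies in \<open>Q\<close>, has the same length two, and
  is therefore the same word.\<close>

lemma exclusion_le_families:
  assumes P: "P \<in> set all_families" and Q: "Q \<in> set all_families"
    and le: "exclusion_le (symm_closure (set P)) (symm_closure (set Q))"
  shows "P = Q"
proof -
  have "x \<in> set Q" if x: "x \<in> set P" for x
  proof -
    have len: "length x = 2" and pos: "\<forall>c\<in>set x. 0 < c" using all_families_pairs[OF P x] by auto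
    have "x \<in> symm_closure (set P)" "x \<noteq> []" using x len by (auto simp: symm_closure_def)
    then obtain y where y: "y \<in> symm_closure (set Q)" "sublist y x"
      using sublist_if_Ex_cf_subset le unfolding exclusion_le_def
      by (metis finite_Un finite_imageI finite_set finite.emptyI finite.insertI symm_closure_def)
    then have y_pos: "\<forall>c\<in>set y. 0 < c" using pos set_mono_sublist by blast
    have "y \<in> set Q"
    proof -
      have "\<not> (\<forall>c\<in>set (map uminus z). 0 < c)" if "z \<in> set Q" for z
        using all_families_pairs[OF Q that] by (cases z) auto
      then have "y \<notin> map uminus ` set Q" using y_pos by blast
      moreover have "y \<noteq> [0]" using y_pos by auto
      ultimately show ?thesis using y(1) unfolding symm_closure_def by blast
    qed
    moreover have "y = x"
      using all_families_pairs[OF Q \<open>y \<in> set Q\<close>] len y(2) by (auto simp: sublist_def)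
    ultimately show ?thesis by simp
  qed
  then show ?thesis using all_families_antichain[OF P Q] by blast
qed

lemma symm_closure_all_families:
  "(\<lambda>P. symm_closure (set P)) ` set all_families =
     symm_closure ` {O1, O2, O3, O4, O5, O6, O7, O8, O9} \<union>
     reversal ` symm_closure ` {O1, O2, O3, O4, O5, O6, O7, O8, O9}"
proof -
  have families: "set ` set pair_families = {O1, O2, O3, O4, O5, O6, O7, O8, O9}"
    by (simp add: pair_families_def O1_def O2_def O3_def O4_def O5_def O6_def O7_def O8_def O9_def)
  show ?thesis
    unfolding families[symmetric] all_families_def
    by (simp add: image_Un image_image reversal_symm_closure)
qed

theorem theoremA:
  shows "{X. minimal_exclusion_set 2 X} =
           symm_closure ` {O1, O2, O3, O4, O5, O6, O7, O8, O9} \<union>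
           reversal ` symm_closure ` {O1, O2, O3, O4, O5, O6, O7, O8, O9} \<and>
         card {X. minimal_exclusion_set 2 X} = 18"
proof -
  let ?E = "\<lambda>P. symm_closure (set P)"
  have trans: "exclusion_le X Y \<Longrightarrow> exclusion_le Y Z \<Longrightarrow> exclusion_le X Z" for X Y Z
    unfolding exclusion_le_def by blast
  have minimal: "{X. minimal_exclusion_set 2 X} = ?E ` set all_families"
  proof (intro equalityI subsetI)
    fix X assume "X \<in> {X. minimal_exclusion_set 2 X}"
    then have X: "X \<in> finite_exclusion_sets 2"
      and min: "\<And>Y. Y \<in> finite_exclusion_sets 2 \<Longrightarrow> exclusion_le Y X \<Longrightarrow> Y = X"
      by (auto simp: minimal_exclusion_set_def)
    obtain P where "P \<in> set all_families" "exclusion_le (?E P) X" using family_below[OF X] by blast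
    with min[OF all_families_exclusion] show "X \<in> ?E ` set all_families" by blast
  next
    fix X assume "X \<in> ?E ` set all_families"
    then obtain P where P: "P \<in> set all_families" "X = ?E P" by blast
    \<comment> \<open>A family below \<open>Y\<close> is also below \<open>P\<close>, hence equals
      \<open>P\<close>. So \<open>X\<close> and \<open>Y\<close> lie below each other.\<close>
    have "Y = X" if Y: "Y \<in> finite_exclusion_sets 2" "exclusion_le Y X" for Y
    proof -
      obtain Q where Q: "Q \<in> set all_families" "exclusion_le (?E Q) Y"
        using family_below[OF Y(1)] by blast
      have "exclusion_le (?E Q) (?E P)" using trans[OF Q(2) Y(2)] P(2) by simp
      then have "Q = P" by (rule exclusion_le_families[OF Q(1) P(1)])
      with Q P have "exclusion_le X Y" by simp
      with Y all_families_exclusion[OF P(1)] P(2) show "Y = X"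
        using exclusion_le_antisym unfolding finite_exclusion_sets_def by blast
    qed
    with all_families_exclusion[OF P(1)] P(2) show "X \<in> {X. minimal_exclusion_set 2 X}"
      by (simp add: minimal_exclusion_set_def)
  qed
  \<comment> \<open>Families with equal closures are comparable, hence equal.\<close>
  have "inj_on ?E (set all_families)"
    by (rule inj_onI) (auto intro!: exclusion_le_families simp: exclusion_le_def)
  then have "card (?E ` set all_families) = card (set all_families)" by (rule card_image)
  also have "\<dots> = 18" using distinct_card[OF distinct_all_families] length_all_families by simp
  finally show ?thesis using minimal symm_closure_all_families by simp
qed

end
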